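(* There is a constant $c>0$ such that for every $n\ge1$, the number of distinct P-USOs of the $n$-cube is at most $2^{c n^3}$; i.e., the number of $n$-dimensional P-USOs is $2^{O(n^3)}$.
   Context: For $v\in\{0,1\}^n$ and $I\subseteq[n]$, $v\oplus I$ is obtained from $v$ by flipping the coordinates in $I$; $v\oplus i:=v\oplus\{i\}$. The $n$-cube is the graph with vertex set $\{0,1\}^n$ and edges $\{v,v\oplus i\}$. A subcube is the induced subgraph on a vertex set $\{v\oplus I: I\subseteq C\}$ for some vertex $v$ and $C\subseteq[n]$. A unique-sink orientation (USO) is an orientation of the $n$-cube in which every subcube has exactly one sink (vertex of outdegree zero within the subcube). A P-matrix is a square real matrix all of whose principal minors are positive. For $B\subseteq[n]$, $A_B$ is the $n\times n$ matrix whose $i$th column is the $i$th column of $-M$ if $i\in B$ and of $I_n$ otherwise; $B(v)=\{j: v_j=1\}$. For a P-matrix $M$ and $q\in\mathbb{R}^n$, the pair $(M,q)$ is nondegenerate if $(A_B^{-1}q)_i\ne0$ for all $B\subseteq[n]$, $i\in[n]$; then the orientation induced by $\mathrm{LCP}(M,q)$ is defined by $v\to v\oplus i$ iff $(A_{B(v)}^{-1}q)_i<0$, and it is a USO. A P-USO is a USO induced in this way by some nondegenerate $(M,q)$ with $M$ a P-matrix. *)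

theory Defs
  imports "Jordan_Normal_Form.Determinant" "Jordan_Normal_Form.DL_Submatrix"
          "Jordan_Normal_Form.Gauss_Jordan_Elimination"
begin

(* Vertices of the n-cube: v in {0,1}^n is identified with B(v) = {j. v_j = 1},
   a subset of the index set {0..<n} (coordinates indexed 0..n-1). *)
definition cube_vertices :: "nat \<Rightarrow> nat set set" where
  "cube_vertices n = Pow {0..<n}"

definition flipset :: "nat set \<Rightarrow> nat set \<Rightarrow> nat set" where
  "flipset v I = (v - I) \<union> (I - v)"

definition flip :: "nat set \<Rightarrow> nat \<Rightarrow> nat set" where
  "flip v i = flipset v {i}"

definition orientation :: "nat \<Rightarrow> (nat set \<times> nat set) set \<Rightarrow> bool" where
  "orientation n Or \<longleftrightarrow>
     Or \<subseteq> {(v, flip v i) | v i. v \<in> cube_vertices n \<and> i < n} \<and>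
     (\<forall>v \<in> cube_vertices n. \<forall>i < n. ((v, flip v i) \<in> Or) \<noteq> ((flip v i, v) \<in> Or))"

definition is_sink :: "(nat set \<times> nat set) set \<Rightarrow> nat set \<Rightarrow> nat set \<Rightarrow> bool" where
  "is_sink Or C w \<longleftrightarrow> (\<forall>i \<in> C. (w, flip w i) \<notin> Or)"

definition subcube :: "nat set \<Rightarrow> nat set \<Rightarrow> nat set set" where
  "subcube v C = {flipset v I | I. I \<subseteq> C}"

definition USO :: "nat \<Rightarrow> (nat set \<times> nat set) set \<Rightarrow> bool" where
  "USO n Or \<longleftrightarrow> orientation n Or \<and>
     (\<forall>v \<in> cube_vertices n. \<forall>C \<subseteq> {0..<n}. \<exists>!w. w \<in> subcube v C \<and> is_sink Or C w)"

definition P_matrix :: "nat \<Rightarrow> real mat \<Rightarrow> bool" where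
  "P_matrix n M \<longleftrightarrow> M \<in> carrier_mat n n \<and>
     (\<forall>I. I \<subseteq> {0..<n} \<and> I \<noteq> {} \<longrightarrow> det (submatrix M I I) > 0)"

definition A_mat :: "nat \<Rightarrow> real mat \<Rightarrow> nat set \<Rightarrow> real mat" where
  "A_mat n M B = mat n n (\<lambda>(i, j). if j \<in> B then - (M $$ (i, j)) else (if i = j then 1 else 0))"

(* A^{-1} q (only used for invertible A; defaults to the zero vector otherwise) *)
definition inv_apply :: "nat \<Rightarrow> real mat \<Rightarrow> real vec \<Rightarrow> real vec" where
  "inv_apply n A q = (case mat_inverse A of Some Ainv \<Rightarrow> Ainv *\<^sub>v q | None \<Rightarrow> 0\<^sub>v n)"

definition nondegenerate :: "nat \<Rightarrow> real mat \<Rightarrow> real vec \<Rightarrow> bool" where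
  "nondegenerate n M q \<longleftrightarrow>
     (\<forall>B \<subseteq> {0..<n}. \<forall>i < n. inv_apply n (A_mat n M B) q $ i \<noteq> 0)"

definition LCP_orientation :: "nat \<Rightarrow> real mat \<Rightarrow> real vec \<Rightarrow> (nat set \<times> nat set) set" where
  "LCP_orientation n M q =
     {(v, flip v i) | v i. v \<in> cube_vertices n \<and> i < n \<and> inv_apply n (A_mat n M v) q $ i < 0}"

definition P_USO :: "nat \<Rightarrow> (nat set \<times> nat set) set \<Rightarrow> bool" where
  "P_USO n Or \<longleftrightarrow> USO n Or \<and>
     (\<exists>M q. P_matrix n M \<and> q \<in> carrier_vec n \<and> nondegenerate n M q \<and> Or = LCP_orientation n M q)"

end

theory Submission
  imports Defs "HOL-Analysis.Function_Topology" "HOL-Library.Function_Algebras"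
begin

text \<open>
  A P-USO is determined by the signs of \<open>n 2\<^sup>n\<close> polynomials of degree at most \<open>2 n\<close> in the
  \<open>n\<^sup>2 + n\<close> entries of \<open>(M, q)\<close>, by Cramer's rule. So it suffices to bound the number of sign
  patterns of nonvanishing polynomials, as in Warren's theorem.

  Let \<open>F\<close> be the product of the polynomials, of degree at most \<open>D\<close>, and perturb its square to
  \<open>g = F\<^sup>2 - t \<Sum>\<^sub>i x\<^sub>i\<^bsup>2D+2\<^esup>\<close>. For small \<open>t > 0\<close> the function \<open>g\<close> is positive somewhere in every
  nonempty sign cell, while \<open>g \<le> 0\<close> where \<open>F = 0\<close> and far away; hence \<open>g\<close> has a critical
  point in each cell. Every critical point satisfies \<open>x\<^sub>i\<^bsup>2D+1\<^esup> = h\<^sub>i x\<close> with \<open>h\<^sub>i\<close> of degree at most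
  \<open>2 D\<close>, so on the critical points every polynomial agrees with one whose exponents are all
  at most \<open>2 D\<close>. As polynomials separate points, \<open>k\<close> variables allow at most
  \<open>(2D+1)\<^sup>k\<close> critical points; no Bezout theorem or genericity is needed.
\<close>

section \<open>Polynomial functions of bounded degree\<close>

definition monom_fn :: "'i set \<Rightarrow> ('i \<Rightarrow> nat) \<Rightarrow> ('i \<Rightarrow> real) \<Rightarrow> real" where
  "monom_fn I e x = (\<Prod>i\<in>I. x i ^ e i)"

text \<open>Polynomials are represented by the functions they define. The number \<open>d\<close>
  only bounds the total degree, so cancellation needs no care, and rule induction treats one
  monomial at a time.\<close>

inductive poly_fn :: "'i set \<Rightarrow> nat \<Rightarrow> (('i \<Rightarrow> real) \<Rightarrow> real) \<Rightarrow> bool" for I d where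
  zero: "poly_fn I d (\<lambda>_. 0)"
| add_monom: "poly_fn I d f \<Longrightarrow> sum e I \<le> d \<Longrightarrow> poly_fn I d (\<lambda>x. f x + c * monom_fn I e x)"

section \<open>Closure under ring operations and determinants\<close>

lemma poly_fn_monom: "sum e I \<le> d \<Longrightarrow> poly_fn I d (\<lambda>x. c * monom_fn I e x)"
  using poly_fn.add_monom[OF poly_fn.zero, of e I d c] by simp

lemma poly_fn_add:
  assumes "poly_fn I d f" "poly_fn I d g"
  shows "poly_fn I d (\<lambda>x. f x + g x)"
  using assms(2)
proof (induction rule: poly_fn.induct)
  case zero
  then show ?case using assms(1) by simp
next
  case (add_monom g e c)
  then show ?case
    using poly_fn.add_monom[OF add_monom.IH, of e c] by (simp add: add.assoc)
qed

lemma poly_fn_mult_monom: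
  assumes "poly_fn I d f" "sum e' I \<le> d'"
  shows "poly_fn I (d + d') (\<lambda>x. f x * (c' * monom_fn I e' x))"
  using assms(1)
proof (induction rule: poly_fn.induct)
  case zero
  then show ?case by (simp add: poly_fn.zero)
next
  case (add_monom f e c)
  have "sum (\<lambda>i. e i + e' i) I \<le> d + d'"
    using add_monom assms by (simp add: sum.distrib)
  from poly_fn.add_monom[OF add_monom.IH this, of "c * c'"] show ?case
    by (simp add: monom_fn_def power_add prod.distrib algebra_simps)
qed

lemma poly_fn_mult:
  assumes "poly_fn I d f" "poly_fn I d' g"
  shows "poly_fn I (d + d') (\<lambda>x. f x * g x)"
  using assms(2)
proof (induction rule: poly_fn.induct)
  case zero
  then show ?case by (simp add: poly_fn.zero)
next
  case (add_monom g e c)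
  from poly_fn_add[OF add_monom.IH poly_fn_mult_monom[OF assms(1) add_monom.hyps(2)]]
  show ?case by (simp add: algebra_simps)
qed

lemma poly_fn_const: "poly_fn I d (\<lambda>_. c)"
  using poly_fn_monom[of "\<lambda>_. 0" I d c] by (simp add: monom_fn_def)

lemma poly_fn_coord:
  assumes "finite I" "i \<in> I" "1 \<le> d"
  shows "poly_fn I d (\<lambda>x. x i)"
proof -
  have "monom_fn I (\<lambda>j. if j = i then 1 else 0) x = x i" for x
  proof -
    have "monom_fn I (\<lambda>j. if j = i then 1 else 0) x = (\<Prod>j\<in>I. if i = j then x j else 1)"
      unfolding monom_fn_def by (rule prod.cong) auto
    then show ?thesis using assms by simp
  qed
  then show ?thesis
    using poly_fn_monom[of "\<lambda>j. if j = i then 1 else 0" I d 1] assms by simp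
qed

lemma poly_fn_cmult: "poly_fn I d f \<Longrightarrow> poly_fn I d (\<lambda>x. c * f x)"
  using poly_fn_mult[OF poly_fn_const[of I 0 c], of d f] by simp

lemma poly_fn_uminus: "poly_fn I d f \<Longrightarrow> poly_fn I d (\<lambda>x. - f x)"
  using poly_fn_cmult[of I d f "-1"] by simp

lemma poly_fn_sum:
  "(\<And>a. a \<in> A \<Longrightarrow> poly_fn I d (f a)) \<Longrightarrow> poly_fn I d (\<lambda>x. \<Sum>a\<in>A. f a x)"
  by (induction A rule: infinite_finite_induct) (auto intro: poly_fn.zero poly_fn_add)

lemma poly_fn_prod:
  assumes "\<And>a. a \<in> A \<Longrightarrow> poly_fn I d (f a)"
  shows "poly_fn I (card A * d) (\<lambda>x. \<Prod>a\<in>A. f a x)"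
  using assms
proof (induction A rule: infinite_finite_induct)
  case (insert a A)
  then show ?case using poly_fn_mult[of I d "f a" "card A * d"] by simp
qed (auto intro: poly_fn_const)

text \<open>In the Leibniz formula every summand is a signed product of \<open>n\<close>
  entries.\<close>

lemma poly_fn_det:
  assumes "\<And>x. A x \<in> carrier_mat n n"
    and "\<And>i j. i < n \<Longrightarrow> j < n \<Longrightarrow> poly_fn I d (\<lambda>x. A x $$ (i, j))"
  shows "poly_fn I (n * d) (\<lambda>x. det (A x))"
proof -
  have "poly_fn I (n * d)
      (\<lambda>x. \<Sum>p | p permutes {0..<n}. signof p * (\<Prod>i = 0..<n. A x $$ (i, p i)))"
  proof (intro poly_fn_sum poly_fn_cmult)
    fix p assume "p \<in> {p. p permutes {0..<n}}"
    then have "p i < n" if "i < n" for i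
      using permutes_in_image[of p "{0..<n}" i] that by auto
    then show "poly_fn I (n * d) (\<lambda>x. \<Prod>i = 0..<n. A x $$ (i, p i))"
      using poly_fn_prod[of "{0..<n}" I d "\<lambda>i x. A x $$ (i, p i)"] assms(2) by simp
  qed
  then show ?thesis
    by (simp add: det_def'[OF assms(1)])
qed

section \<open>Dependence on coordinates, continuity, growth and derivatives\<close>

lemma poly_fn_cong:
  assumes "poly_fn I d f" "\<And>i. i \<in> I \<Longrightarrow> x i = y i"
  shows "f x = f y"
  using assms(1)
proof (induction rule: poly_fn.induct)
  case (add_monom f e c)
  have "monom_fn I e x = monom_fn I e y"
    unfolding monom_fn_def by (rule prod.cong) (auto simp: assms(2))
  then show ?case using add_monom by simp
qed simp

lemma poly_fn_continuous:
  fixes f :: "('i \<Rightarrow> real) \<Rightarrow> real"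
  assumes "poly_fn I d f"
  shows "continuous_on S f"
  using assms
proof (induction rule: poly_fn.induct)
  case (add_monom f e c)
  have "continuous_on S (\<lambda>x. x i)" for i :: 'i and S :: "('i \<Rightarrow> real) set"
    by (rule continuous_on_subset[OF continuous_on_product_coordinates]) simp
  then have "continuous_on S (monom_fn I e)"
    unfolding monom_fn_def by (rule continuous_on_prod[OF continuous_on_power])
  then show ?case
    by (rule continuous_on_add[OF add_monom.IH continuous_on_mult_left])
qed simp

text \<open>For \<open>R \<ge> 1\<close>, a monomial of degree at most \<open>d\<close> is bounded
  by \<open>R ^ d\<close> on the box of radius \<open>R\<close>; \<open>C\<close> is the sum of the
  absolute values of the coefficients.\<close>

lemma poly_fn_growth:
  assumes "finite I" "poly_fn I d f"
  shows "\<exists>C\<ge>0. \<forall>R\<ge>1. \<forall>x. (\<forall>i\<in>I. \<bar>x i\<bar> \<le> R) \<longrightarrow> \<bar>f x\<bar> \<le> C * R ^ d"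
  using assms(2)
proof (induction rule: poly_fn.induct)
  case zero
  then show ?case by (auto intro: exI[of _ 0])
next
  case (add_monom f e c)
  from add_monom.IH obtain C where C: "C \<ge> 0"
    "\<And>R x. R \<ge> 1 \<Longrightarrow> (\<forall>i\<in>I. \<bar>x i\<bar> \<le> R) \<Longrightarrow> \<bar>f x\<bar> \<le> C * R ^ d" by blast
  have "\<bar>f x + c * monom_fn I e x\<bar> \<le> (C + \<bar>c\<bar>) * R ^ d"
    if R: "R \<ge> 1" and x: "\<forall>i\<in>I. \<bar>x i\<bar> \<le> R" for R x
  proof -
    have "\<bar>monom_fn I e x\<bar> \<le> (\<Prod>i\<in>I. R ^ e i)"
      unfolding monom_fn_def abs_prod
      using x by (intro prod_mono) (auto simp: power_abs intro: power_mono)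
    also have "\<dots> = R ^ sum e I" by (simp add: power_sum)
    also have "\<dots> \<le> R ^ d" using R add_monom by (intro power_increasing) auto
    finally have "\<bar>c\<bar> * \<bar>monom_fn I e x\<bar> \<le> \<bar>c\<bar> * R ^ d" by (intro mult_left_mono) auto
    moreover have "\<bar>f x\<bar> \<le> C * R ^ d" using C R x by blast
    ultimately show ?thesis
      using abs_triangle_ineq[of "f x" "c * monom_fn I e x"]
      by (simp add: abs_mult distrib_right)
  qed
  then show ?case using C(1) by (intro exI[of _ "C + \<bar>c\<bar>"]) auto
qed

lemma poly_fn_partial_derivative:
  assumes "finite I" "i \<in> I" "poly_fn I d f"
  shows "\<exists>f'. poly_fn I d f' \<and>
    (\<forall>x. ((\<lambda>s. f (x(i := s))) has_field_derivative f' x) (at (x i)))"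
  using assms(3)
proof (induction rule: poly_fn.induct)
  case zero
  then show ?case by (intro exI[of _ "\<lambda>_. 0"]) (auto intro: poly_fn.zero)
next
  case (add_monom f e c)
  from add_monom.IH obtain f' where f': "poly_fn I d f'"
    "\<And>x. ((\<lambda>s. f (x(i := s))) has_field_derivative f' x) (at (x i))" by blast
  \<comment> \<open>If \<open>e i = 0\<close>, the truncated subtraction is harmless because the
    coefficient \<open>real (e i)\<close> vanishes.\<close>
  let ?e = "e(i := e i - 1)"
  let ?g = "\<lambda>x. f' x + (c * real (e i)) * monom_fn I ?e x"
  have split: "monom_fn I e' x = x i ^ e' i * (\<Prod>j\<in>I-{i}. x j ^ e' j)" for e' x
    unfolding monom_fn_def using assms by (simp add: prod.remove)
  have "sum ?e I \<le> sum e I" by (rule sum_mono) auto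
  then have "poly_fn I d ?g"
    using add_monom f' by (intro poly_fn.add_monom) auto
  moreover have "((\<lambda>s. f (x(i := s)) + c * monom_fn I e (x(i := s)))
      has_field_derivative ?g x) (at (x i))" for x
  proof -
    have eq1: "monom_fn I e (x(i := s)) = s ^ e i * (\<Prod>j\<in>I-{i}. x j ^ e j)" for s
      unfolding split by (auto intro: prod.cong)
    have eq2: "monom_fn I ?e x = x i ^ (e i - 1) * (\<Prod>j\<in>I-{i}. x j ^ e j)"
      unfolding split by (auto intro: prod.cong)
    show ?thesis
      unfolding eq1 eq2 by (auto intro!: derivative_eq_intros f'(2))
  qed
  ultimately show ?case by blast
qed

section \<open>Common zeros of polynomials with pure power leading forms\<close>

text \<open>A dimension count: the indicators of the points of \<open>Z\<close> are linearly
  independent and lie in a space spanned by at most \<open>card E\<close> functions.\<close>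

lemma card_le_if_indicators_spanned:
  fixes b :: "'e \<Rightarrow> 'a \<Rightarrow> real"
  assumes "finite Z" "finite E"
    and span: "\<And>z. z \<in> Z \<Longrightarrow>
      \<exists>c. \<forall>w\<in>Z. (\<Sum>e\<in>E. c e * b e w) = (if w = z then 1 else 0)"
  shows "card Z \<le> card E"
proof -
  interpret fs: vector_space "\<lambda>(c::real) (f::'a \<Rightarrow> real) x. c * f x"
    by unfold_locales (auto simp: fun_eq_iff algebra_simps)
  have sum_app: "sum f A x = (\<Sum>a\<in>A. f a x)" for f :: "'c \<Rightarrow> 'a \<Rightarrow> real" and A x
    by (induction A rule: infinite_finite_induct) auto
  define u where "u z = (\<lambda>x. if x = z then 1 else 0 :: real)" for z :: 'a
  \<comment> \<open>The \<open>b e\<close> are cut off outside \<open>Z\<close>, since the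
    hypothesis controls their combinations only on \<open>Z\<close> while equality of functions is
    global.\<close>
  define T where "T = (\<lambda>e x. if x \<in> Z then b e x else 0) ` E"
  have inj: "inj_on u Z"
    by (rule inj_onI) (metis u_def zero_neq_one)
  have "fs.independent (u ` Z)"
  proof (rule fs.independent_if_scalars_zero)
    fix f x assume s: "(\<Sum>x\<in>u ` Z. (\<lambda>y. f x * x y)) = 0" and "x \<in> u ` Z"
    then obtain z where z: "z \<in> Z" "x = u z" by blast
    have "0 = (\<Sum>x\<in>u ` Z. f x * x z)"
      using arg_cong[OF s, of "\<lambda>h. h z"] by (simp add: sum_app)
    also have "\<dots> = (\<Sum>w\<in>Z. if w = z then f (u w) else 0)"
      unfolding sum.reindex[OF inj] by (rule sum.cong) (auto simp: u_def)
    also have "\<dots> = f (u z)" using z assms(1) by simp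
    finally show "f x = 0" using z by simp
  qed (use assms in auto)
  moreover have "u ` Z \<subseteq> fs.span T"
  proof
    fix y assume "y \<in> u ` Z"
    then obtain z where z: "z \<in> Z" "y = u z" by blast
    obtain c where c: "\<forall>w\<in>Z. (\<Sum>e\<in>E. c e * b e w) = (if w = z then 1 else 0)"
      using span[OF z(1)] by blast
    have "y = (\<Sum>e\<in>E. (\<lambda>x. c e * (if x \<in> Z then b e x else 0)))"
    proof
      fix x show "y x = (\<Sum>e\<in>E. (\<lambda>x. c e * (if x \<in> Z then b e x else 0))) x"
        using c z by (cases "x \<in> Z") (auto simp: sum_app u_def)
    qed
    also have "\<dots> \<in> fs.span T"
      by (intro fs.span_sum fs.span_scale fs.span_base) (auto simp: T_def)
    finally show "y \<in> fs.span T" .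
  qed
  ultimately have "card (u ` Z) \<le> card T"
    using fs.independent_span_bound[of T "u ` Z"] assms by (simp add: T_def)
  also have "\<dots> \<le> card E" unfolding T_def by (rule card_image_le) fact
  finally show ?thesis by (simp add: card_image inj)
qed

text \<open>Replacing a factor \<open>x i ^ m\<close> by \<open>h i x\<close> preserves values on
  \<open>Z\<close> and lowers the degree bound by \<open>m - d0 > 0\<close>. Strong induction on the
  degree therefore ends with all exponents below \<open>m\<close>.\<close>

lemma poly_fn_reduce:
  assumes I: "finite I" and "d0 < m"
    and h: "\<And>i. i \<in> I \<Longrightarrow> poly_fn I d0 (h i)"
    and Z: "\<And>x i. x \<in> Z \<Longrightarrow> i \<in> I \<Longrightarrow> x i ^ m = h i x"
  shows "poly_fn I d f \<Longrightarrow>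
    \<exists>c. \<forall>x\<in>Z. (\<Sum>e \<in> I \<rightarrow>\<^sub>E {..<m}. c e * monom_fn I e x) = f x"
proof (induction d arbitrary: f rule: less_induct)
  case (less d)
  let ?Q = "\<lambda>f. \<exists>c. \<forall>x\<in>Z. (\<Sum>e \<in> I \<rightarrow>\<^sub>E {..<m}. c e * monom_fn I e x) = f x"
  have fin: "finite (I \<rightarrow>\<^sub>E {..<m})" using I by (intro finite_PiE) auto
  have monom: "?Q (monom_fn I e)" if e: "sum e I \<le> d" for e
  proof (cases "\<forall>i\<in>I. e i < m")
    case True
    \<comment> \<open>Members of the extensional product are undefined outside \<open>I\<close>, so
      the exponent function has to be restricted first.\<close>
    then have mem: "restrict e I \<in> I \<rightarrow>\<^sub>E {..<m}" by auto
    have "monom_fn I (restrict e I) x = monom_fn I e x" for x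
      unfolding monom_fn_def by (rule prod.cong) auto
    moreover have "(\<Sum>e' \<in> I \<rightarrow>\<^sub>E {..<m}. (if e' = restrict e I then 1 else 0) * monom_fn I e' x)
        = monom_fn I (restrict e I) x" for x
      using fin mem by (simp add: if_distrib[of "\<lambda>a. a * _"] cong: if_cong)
    ultimately show ?thesis by (intro exI[of _ "\<lambda>e'. if e' = restrict e I then 1 else 0"]) auto
  next
    case False
    then obtain i where i: "i \<in> I" "e i \<ge> m" by auto
    let ?e = "e(i := e i - m)"
    have eq: "monom_fn I e x = 1 * monom_fn I ?e x * h i x" if "x \<in> Z" for x
    proof -
      have "monom_fn I e x = x i ^ e i * (\<Prod>j\<in>I-{i}. x j ^ e j)"
        unfolding monom_fn_def using I i by (simp add: prod.remove)
      also have "x i ^ e i = x i ^ (e i - m) * h i x"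
        using Z[OF that i(1)] i(2) by (metis le_add_diff_inverse2 power_add)
      also have "(\<Prod>j\<in>I-{i}. x j ^ e j) = (\<Prod>j\<in>I-{i}. x j ^ ?e j)" by (rule prod.cong) auto
      also have "x i ^ (e i - m) * h i x * \<dots> = monom_fn I ?e x * h i x"
        unfolding monom_fn_def using I i by (simp add: prod.remove)
      finally show ?thesis by simp
    qed
    have "sum e I = e i + sum e (I - {i})" "sum ?e I = e i - m + sum ?e (I - {i})"
      using I i by (simp_all add: sum.remove)
    moreover have "sum ?e (I - {i}) = sum e (I - {i})" by (rule sum.cong) auto
    ultimately have "sum ?e I + d0 < d" using e i \<open>d0 < m\<close> by linarith
    moreover have "poly_fn I (sum ?e I + d0) (\<lambda>x. 1 * monom_fn I ?e x * h i x)"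
      by (intro poly_fn_mult poly_fn_monom h i) simp
    ultimately have "?Q (\<lambda>x. 1 * monom_fn I ?e x * h i x)" by (rule less.IH)
    then show ?thesis using eq by fastforce
  qed
  show ?case using less.prems
  proof (induction rule: poly_fn.induct)
    case zero
    then show ?case by (intro exI[of _ "\<lambda>_. 0"]) simp
  next
    case (add_monom f e c)
    obtain c1 c2 where
      "\<forall>x\<in>Z. (\<Sum>e \<in> I \<rightarrow>\<^sub>E {..<m}. c1 e * monom_fn I e x) = f x"
      "\<forall>x\<in>Z. (\<Sum>e \<in> I \<rightarrow>\<^sub>E {..<m}. c2 e * monom_fn I e x) = monom_fn I e x"
      using add_monom.IH monom[OF add_monom.hyps(2)] by blast
    then show ?case
      by (intro exI[of _ "\<lambda>e. c1 e + c * c2 e"])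
        (simp add: distrib_right sum.distrib mult.assoc flip: sum_distrib_left)
  qed
qed

text \<open>Lagrange interpolation makes each point indicator a polynomial on \<open>Z\<close>.
  After reduction it is a combination of the \<open>m ^ card I\<close> monomials with exponents
  below \<open>m\<close>. The support condition ensures that distinct points differ in a coordinate
  from \<open>I\<close>.\<close>

lemma card_common_zeros_le:
  assumes I: "finite I" and "d0 < m"
    and h: "\<And>i. i \<in> I \<Longrightarrow> poly_fn I d0 (h i)"
    and Z: "\<And>x i. x \<in> Z \<Longrightarrow> i \<in> I \<Longrightarrow> x i ^ m = h i x"
    and supp: "\<And>x i. x \<in> Z \<Longrightarrow> i \<notin> I \<Longrightarrow> x i = 0"
    and "finite Z"
  shows "card Z \<le> m ^ card I"
proof -
  have "card Z \<le> card (I \<rightarrow>\<^sub>E {..<m})"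
  proof (rule card_le_if_indicators_spanned[where b = "monom_fn I"])
    show "finite (I \<rightarrow>\<^sub>E {..<m})" using I by (intro finite_PiE) auto
    fix z assume z: "z \<in> Z"
    have "\<exists>i\<in>I. z i \<noteq> w i" if "w \<in> Z - {z}" for w
    proof (rule ccontr)
      assume "\<not> ?thesis"
      then have "z = w" using supp z that by (intro ext) (metis DiffD1)
      then show False using that by simp
    qed
    then obtain j where j: "\<And>w. w \<in> Z - {z} \<Longrightarrow> j w \<in> I \<and> z (j w) \<noteq> w (j w)" by metis
    \<comment> \<open>The factor for \<open>w\<close> is 1 at \<open>z\<close> and 0 at
      \<open>w\<close>. The degree of the product does not matter, because the reduction accepts any
      degree.\<close>
    define f where "f x = (\<Prod>w\<in>Z-{z}. inverse (z (j w) - w (j w)) * (x (j w) + - w (j w)))" for x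
    have "poly_fn I (card (Z - {z}) * 1) f"
      unfolding f_def using j I
      by (intro poly_fn_prod poly_fn_cmult poly_fn_add poly_fn_const poly_fn_coord) auto
    from poly_fn_reduce[OF I \<open>d0 < m\<close> h Z this]
    obtain c where c: "\<forall>x\<in>Z. (\<Sum>e \<in> I \<rightarrow>\<^sub>E {..<m}. c e * monom_fn I e x) = f x" by blast
    moreover have "f z = 1" unfolding f_def by (rule prod.neutral) (use j in auto)
    moreover have "f w = 0" if "w \<in> Z" "w \<noteq> z" for w
      unfolding f_def using that \<open>finite Z\<close> by (intro prod_zero) auto
    ultimately show "\<exists>c. \<forall>w\<in>Z. (\<Sum>e \<in> I \<rightarrow>\<^sub>E {..<m}. c e * monom_fn I e w) = (if w = z then 1 else 0)"
      by (intro exI[of _ c]) auto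
  qed fact
  also have "\<dots> = m ^ card I" using I by (simp add: card_PiE)
  finally show ?thesis .
qed

section \<open>Counting sign patterns\<close>

text \<open>As \<open>t\<close> tends to 0 from the right, each \<open>t * u a\<close> tends to 0,
  and finitely many eventual conditions hold together.\<close>

lemma exists_small_scaling:
  fixes u v :: "'a \<Rightarrow> real"
  assumes "finite A" "\<And>a. a \<in> A \<Longrightarrow> 0 < v a"
  shows "\<exists>t>0. \<forall>a\<in>A. t * u a < v a"
proof -
  have "eventually (\<lambda>t. t * u a < v a) (at_right 0)" if "a \<in> A" for a
  proof -
    have "((\<lambda>t. t * u a) \<longlongrightarrow> 0 * u a) (at_right 0)" by (intro tendsto_intros)
    then show ?thesis using order_tendstoD(2) assms(2)[OF that] by fastforce
  qed
  then have "eventually (\<lambda>t. \<forall>a\<in>A. t * u a < v a) (at_right 0)"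
    using assms(1) by (intro eventually_ball_finite) auto
  then have "eventually (\<lambda>t. 0 < t \<and> (\<forall>a\<in>A. t * u a < v a)) (at_right (0::real))"
    by (rule eventually_conj[OF eventually_at_right_less])
  then show ?thesis
    using eventually_happens'[OF trivial_limit_at_right_real] by blast
qed

text \<open>Tychonoff: the set is a product of intervals over \<open>I\<close> and singletons
  elsewhere, so the index type may be infinite.\<close>

lemma compact_box:
  "compact {x :: 'i \<Rightarrow> real. (\<forall>i\<in>I. \<bar>x i\<bar> \<le> R) \<and> (\<forall>i. i \<notin> I \<longrightarrow> x i = 0)}"
proof -
  let ?S = "\<lambda>i. if i \<in> I then {- R..R} else {0}"
  have "compactin (product_topology (\<lambda>i. euclidean) UNIV) (PiE UNIV ?S)"
    unfolding compactin_PiE by simp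
  then have "compact (PiE UNIV ?S)"
    by (simp add: euclidean_product_topology)
  also have "PiE UNIV ?S = {x. (\<forall>i\<in>I. \<bar>x i\<bar> \<le> R) \<and> (\<forall>i. i \<notin> I \<longrightarrow> x i = 0)}"
    by (auto simp: PiE_iff abs_le_iff minus_le_iff split: if_splits)
  finally show ?thesis .
qed

theorem card_sign_patterns_le:
  fixes P :: "'j \<Rightarrow> ('i \<Rightarrow> real) \<Rightarrow> real"
  assumes I: "finite I" and J: "finite J" and P: "\<And>j. j \<in> J \<Longrightarrow> poly_fn I d (P j)"
  shows "card {{j\<in>J. P j x < 0} | x. \<forall>j\<in>J. P j x \<noteq> 0} \<le> (2 * (card J * d) + 1) ^ card I"
proof -
  define S where "S = {{j\<in>J. P j x < 0} | x. \<forall>j\<in>J. P j x \<noteq> 0}"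
  define D where "D = card J * d"
  have "S \<subseteq> Pow J" unfolding S_def by auto
  then have finS: "finite S" using J finite_subset by auto
  have "\<exists>x. (\<forall>j\<in>J. P j x \<noteq> 0) \<and> (\<forall>j\<in>J. j \<in> \<sigma> \<longleftrightarrow> P j x < 0) \<and> (\<forall>i. i \<notin> I \<longrightarrow> x i = 0)"
    if \<sigma>: "\<sigma> \<in> S" for \<sigma>
  proof -
    obtain x where x: "\<forall>j\<in>J. P j x \<noteq> 0" "\<sigma> = {j\<in>J. P j x < 0}"
      using \<sigma> unfolding S_def by blast
    \<comment> \<open>Only coordinates in \<open>I\<close> influence \<open>P j\<close>, so a
      representative of the pattern can be set to 0 off \<open>I\<close>, which puts it into a
      compact box.\<close>
    have "P j (\<lambda>i. if i \<in> I then x i else 0) = P j x" if "j \<in> J" for j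
      by (rule poly_fn_cong[OF P[OF that]]) simp
    then show ?thesis
      using x by (intro exI[of _ "\<lambda>i. if i \<in> I then x i else 0"]) auto
  qed
  then have "\<exists>r. \<forall>\<sigma>\<in>S. (\<forall>j\<in>J. P j (r \<sigma>) \<noteq> 0) \<and> (\<forall>j\<in>J. j \<in> \<sigma> \<longleftrightarrow> P j (r \<sigma>) < 0) \<and>
      (\<forall>i. i \<notin> I \<longrightarrow> r \<sigma> i = 0)"
    by (intro bchoice ballI)
  then obtain r where rS: "\<forall>\<sigma>\<in>S. (\<forall>j\<in>J. P j (r \<sigma>) \<noteq> 0) \<and>
      (\<forall>j\<in>J. j \<in> \<sigma> \<longleftrightarrow> P j (r \<sigma>) < 0) \<and> (\<forall>i. i \<notin> I \<longrightarrow> r \<sigma> i = 0)" ..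
  have r: "j \<in> J \<Longrightarrow> P j (r \<sigma>) \<noteq> 0" "j \<in> J \<Longrightarrow> j \<in> \<sigma> \<longleftrightarrow> P j (r \<sigma>) < 0"
    "i \<notin> I \<Longrightarrow> r \<sigma> i = 0" if "\<sigma> \<in> S" for \<sigma> j i
    using bspec[OF rS that] by simp_all

  define F where "F x = (\<Prod>j\<in>J. P j x)" for x
  have F: "poly_fn I D F" unfolding F_def D_def using P by (rule poly_fn_prod)
  have F_nz: "F x \<noteq> 0 \<longleftrightarrow> (\<forall>j\<in>J. P j x \<noteq> 0)" for x unfolding F_def using J by simp
  \<comment> \<open>The exponent is even, so \<open>W\<close> is nonnegative, and it exceeds the
    degree bound \<open>2 * D\<close> of the square of \<open>F\<close>, so \<open>W\<close>
    dominates far away.\<close>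
  define W where "W x = (\<Sum>i\<in>I. x i ^ (2 * D + 2))" for x :: "'i \<Rightarrow> real"
  have even: "even (2 * D + 2)" by simp
  have W_ge: "0 \<le> W x" for x unfolding W_def by (intro sum_nonneg zero_le_even_power even)
  \<comment> \<open>One \<open>t\<close> serves all patterns: it makes \<open>g\<close> positive at
    each of the finitely many representatives.\<close>
  obtain t where t: "t > 0" "\<And>\<sigma>. \<sigma> \<in> S \<Longrightarrow> t * W (r \<sigma>) < (F (r \<sigma>))\<^sup>2"
    using exists_small_scaling[OF finS, of "\<lambda>\<sigma>. (F (r \<sigma>))\<^sup>2" "\<lambda>\<sigma>. W (r \<sigma>)"] r(1) F_nz
    by auto
  define g where "g x = (F x)\<^sup>2 - t * W x" for x
  have g_cont: "continuous_on A g" for A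
  proof -
    have c: "continuous_on A (\<lambda>x. x i)" for i :: 'i
      by (rule continuous_on_subset[OF continuous_on_product_coordinates]) simp
    have "continuous_on A W"
      unfolding W_def by (rule continuous_on_sum[OF continuous_on_power[OF c]])
    then show ?thesis unfolding g_def
      by (rule continuous_on_diff[OF continuous_on_power[OF poly_fn_continuous[OF F]]
            continuous_on_mult_left])
  qed
  have g_posD: "F x \<noteq> 0" if "g x > 0" for x
  proof -
    have "0 \<le> t * W x" using W_ge t(1) by (intro mult_nonneg_nonneg) auto
    then show ?thesis using that by (auto simp: g_def)
  qed

  obtain C where C: "C \<ge> 0" "\<And>R x. R \<ge> 1 \<Longrightarrow> (\<forall>i\<in>I. \<bar>x i\<bar> \<le> R) \<Longrightarrow> \<bar>F x\<bar> \<le> C * R ^ D"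
    using poly_fn_growth[OF I F] by blast
  \<comment> \<open>The summand 1 allows the growth bound, the quotient lets \<open>t * W\<close>
    outweigh the square of \<open>F\<close> on the boundary, and the double sum puts every
    representative into the box.\<close>
  define R where "R = 1 + C\<^sup>2 / t + (\<Sum>\<sigma>\<in>S. \<Sum>i\<in>I. \<bar>r \<sigma> i\<bar>)"
  have nn: "0 \<le> C\<^sup>2 / t" "0 \<le> (\<Sum>\<sigma>\<in>S. \<Sum>i\<in>I. \<bar>r \<sigma> i\<bar>)"
    using t(1) by (auto intro!: sum_nonneg)
  have R1: "R \<ge> 1" and RC: "R \<ge> C\<^sup>2 / t" using nn by (auto simp: R_def)
  have Rr: "\<bar>r \<sigma> i\<bar> \<le> R" if "\<sigma> \<in> S" "i \<in> I" for \<sigma> i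
  proof -
    have "\<bar>r \<sigma> i\<bar> \<le> (\<Sum>i\<in>I. \<bar>r \<sigma> i\<bar>)" using I that by (intro member_le_sum) auto
    also have "\<dots> \<le> (\<Sum>\<sigma>\<in>S. \<Sum>i\<in>I. \<bar>r \<sigma> i\<bar>)"
      using finS that by (intro member_le_sum) (auto intro: sum_nonneg)
    finally show ?thesis using nn by (simp add: R_def)
  qed
  \<comment> \<open>A maximum with a positive value of \<open>g\<close> therefore cannot lie on the
    boundary of the box.\<close>
  have g_boundary: "g x \<le> 0" if x: "\<forall>i\<in>I. \<bar>x i\<bar> \<le> R" and i: "i \<in> I" "\<bar>x i\<bar> = R" for x i
  proof -
    have "(F x)\<^sup>2 \<le> (C * R ^ D)\<^sup>2"
      using C(2)[OF R1 x] by (metis abs_ge_zero power2_abs power_mono)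
    also have "\<dots> = C\<^sup>2 * R ^ (2 * D)" by (simp add: power_mult_distrib power_mult mult.commute)
    also have "\<dots> \<le> (t * R\<^sup>2) * R ^ (2 * D)"
    proof (rule mult_right_mono)
      have "C\<^sup>2 \<le> t * R" using RC t(1) by (simp add: field_simps)
      also have "\<dots> \<le> t * R\<^sup>2" using t(1) R1 by (intro mult_left_mono) (auto simp: power2_eq_square)
      finally show "C\<^sup>2 \<le> t * R\<^sup>2" .
    qed (use R1 in auto)
    also have "\<dots> = t * R ^ (2 * D + 2)" by (simp add: power_add power2_eq_square)
    also have "R ^ (2 * D + 2) = x i ^ (2 * D + 2)"
      using i(2) even by (metis power_even_abs)
    also have "t * x i ^ (2 * D + 2) \<le> t * W x"
      unfolding W_def using t(1) I i(1) by (intro mult_left_mono member_le_sum zero_le_even_power even) auto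
    finally show ?thesis unfolding g_def by simp
  qed

  obtain F' where F': "\<And>i. i \<in> I \<Longrightarrow> poly_fn I D (F' i)"
    "\<And>i x. i \<in> I \<Longrightarrow> ((\<lambda>s. F (x(i := s))) has_field_derivative F' i x) (at (x i))"
    using poly_fn_partial_derivative[OF I _ F] by metis
  \<comment> \<open>This solves the vanishing of the \<open>i\<close>-th partial derivative of
    \<open>g\<close>, namely \<open>2 * F x * F' i x = t * (2 * D + 2) * x i ^ (2 * D + 1)\<close>,
    for the pure power.\<close>
  define h where "h i x = inverse (t * (real D + 1)) * (F x * F' i x)" for i x

  have "\<exists>z. {j\<in>J. P j z < 0} = \<sigma> \<and> (\<forall>i. i \<notin> I \<longrightarrow> z i = 0) \<and>
      (\<forall>i\<in>I. z i ^ (2 * D + 1) = h i z)" if \<sigma>: "\<sigma> \<in> S" for \<sigma>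
  proof -
    define sg :: "'j \<Rightarrow> real" where "sg j = (if j \<in> \<sigma> then -1 else 1)" for j
    define B where "B = {x. (\<forall>i\<in>I. \<bar>x i\<bar> \<le> R) \<and> (\<forall>i. i \<notin> I \<longrightarrow> x i = 0)}"
    \<comment> \<open>Weak inequalities make \<open>K\<close> closed, hence compact. Positivity of
      \<open>g\<close> at the maximum will rule out zeros of the \<open>P j\<close> there.\<close>
    define K where "K = B \<inter> (\<Inter>j\<in>J. {x. 0 \<le> sg j * P j x})"
    have "closed {x. 0 \<le> sg j * P j x}" if "j \<in> J" for j
      by (intro closed_Collect_le continuous_on_const
          continuous_on_mult_left[OF poly_fn_continuous[OF P[OF that]]])
    then have "compact K" unfolding K_def
      by (intro compact_Int_closed closed_INT ballI) (simp_all only: B_def compact_box)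
    moreover have rK: "r \<sigma> \<in> K"
    proof -
      have "0 \<le> sg j * P j (r \<sigma>)" if "j \<in> J" for j
        using r(2)[OF \<sigma> that] by (auto simp: sg_def)
      then show ?thesis using Rr \<sigma> r(3) by (simp add: K_def B_def)
    qed
    ultimately obtain z where z: "z \<in> K" "\<And>y. y \<in> K \<Longrightarrow> g y \<le> g z"
      using continuous_attains_sup[of K g] g_cont by blast
    have "0 < g (r \<sigma>)" using t(2)[OF \<sigma>] by (simp add: g_def)
    then have gz: "0 < g z" using z(2)[OF rK] by simp
    then have nz: "\<forall>j\<in>J. P j z \<noteq> 0" using g_posD F_nz by blast
    have pos: "0 < sg j * P j z" if "j \<in> J" for j
      using z(1) nz that by (auto simp: K_def sg_def less_le)
    have pat: "{j\<in>J. P j z < 0} = \<sigma>"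
    proof -
      have "\<sigma> \<subseteq> J" using \<sigma> \<open>S \<subseteq> Pow J\<close> by blast
      moreover have "P j z < 0 \<longleftrightarrow> j \<in> \<sigma>" if "j \<in> J" for j
        using pos[OF that] by (auto simp: sg_def split: if_splits)
      ultimately show ?thesis by blast
    qed
    have zB: "\<forall>i\<in>I. \<bar>z i\<bar> \<le> R" "\<forall>i. i \<notin> I \<longrightarrow> z i = 0"
      using z(1) by (auto simp: K_def B_def)
    have "z i ^ (2 * D + 1) = h i z" if i: "i \<in> I" for i
    proof -
      \<comment> \<open>This is the partial derivative of \<open>g\<close> at \<open>z\<close> in
        direction \<open>i\<close>.\<close>
      let ?l = "2 * (F z * F' i z) - t * (real (2 * D + 2) * z i ^ (2 * D + 1))"
      have zi: "\<bar>z i\<bar> < R"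
        using g_boundary[OF zB(1) i] gz zB(1) i by fastforce
      \<comment> \<open>All constraints on coordinates in \<open>I\<close> and all sign conditions
        are strict at \<open>z\<close>, so a small change of one coordinate stays in
        \<open>K\<close>. The maximum over \<open>K\<close> is thus a local maximum along this
        line.\<close>
      have ev_K: "eventually (\<lambda>s. z(i := s) \<in> K) (nhds (z i))"
      proof -
        have "eventually (\<lambda>s. 0 < sg j * P j (z(i := s))) (nhds (z i))" if j: "j \<in> J" for j
        proof -
          obtain p where "((\<lambda>s. P j (z(i := s))) has_field_derivative p) (at (z i))"
            using poly_fn_partial_derivative[OF I i P[OF j]] by blast
          then have cont: "isCont (\<lambda>s. sg j * P j (z(i := s))) (z i)"
            by (intro continuous_intros DERIV_isCont)
          define q where "q s = sg j * P j (z(i := s))" for s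
          have "(q \<longlongrightarrow> q (z i)) (nhds (z i))"
            using cont unfolding isCont_def q_def[symmetric] tendsto_at_iff_tendsto_nhds .
          then have "((\<lambda>s. sg j * P j (z(i := s))) \<longlongrightarrow> sg j * P j z) (nhds (z i))"
            by (simp add: q_def[abs_def])
          then show ?thesis using order_tendstoD(1) pos[OF j] by blast
        qed
        then have "eventually (\<lambda>s. \<forall>j\<in>J. 0 < sg j * P j (z(i := s))) (nhds (z i))"
          using J by (intro eventually_ball_finite) auto
        moreover have "eventually (\<lambda>s. \<bar>s\<bar> < R) (nhds (z i))"
        proof -
          have "((\<lambda>s. \<bar>s\<bar>) \<longlongrightarrow> \<bar>z i\<bar>) (nhds (z i))" by (intro tendsto_intros filterlim_ident)
          then show ?thesis using order_tendstoD(2) zi by blast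
        qed
        ultimately show ?thesis
        proof eventually_elim
          case (elim s)
          then show ?case using zB i by (auto simp: K_def B_def less_imp_le)
        qed
      qed
      then obtain \<delta> where \<delta>: "\<delta> > 0" "\<And>s. dist s (z i) < \<delta> \<Longrightarrow> z(i := s) \<in> K"
        unfolding eventually_nhds_metric by blast
      have W_upd: "W (z(i := s)) = s ^ (2 * D + 2) + (\<Sum>j\<in>I-{i}. z j ^ (2 * D + 2))" for s
        unfolding W_def sum.remove[OF I i] by simp
      have "((\<lambda>s. g (z(i := s))) has_field_derivative ?l) (at (z i))"
      proof -
        define p where "p s = s ^ (2 * D + 2)" for s :: real
        have "(p has_field_derivative real (2 * D + 2) * z i ^ (2 * D + 1)) (at (z i))"
          using DERIV_pow[of "2 * D + 2" "z i"] by (simp add: p_def[abs_def])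
        then show ?thesis
          unfolding g_def W_upd p_def[symmetric]
          by (auto intro!: derivative_eq_intros F'(2)[OF i])
      qed
      then have "?l = 0"
        by (rule DERIV_local_max[OF _ \<delta>(1)]) (use z(2) \<delta>(2) in \<open>auto simp: dist_real_def abs_minus_commute\<close>)
      then have eq: "F z * F' i z = (t * (real D + 1)) * z i ^ (2 * D + 1)"
        by (simp add: algebra_simps)
      have "y = inverse a * (a * y)" if "a \<noteq> 0" for a y :: real using that by simp
      moreover have "t * (real D + 1) \<noteq> 0" using t(1) by simp
      ultimately show ?thesis unfolding h_def eq by blast
    qed
    then show ?thesis using pat zB by blast
  qed
  then have "\<exists>z. \<forall>\<sigma>\<in>S. {j\<in>J. P j (z \<sigma>) < 0} = \<sigma> \<and> (\<forall>i. i \<notin> I \<longrightarrow> z \<sigma> i = 0) \<and>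
      (\<forall>i\<in>I. z \<sigma> i ^ (2 * D + 1) = h i (z \<sigma>))"
    by (intro bchoice ballI)
  then obtain z where zS: "\<forall>\<sigma>\<in>S. {j\<in>J. P j (z \<sigma>) < 0} = \<sigma> \<and>
      (\<forall>i. i \<notin> I \<longrightarrow> z \<sigma> i = 0) \<and> (\<forall>i\<in>I. z \<sigma> i ^ (2 * D + 1) = h i (z \<sigma>))" ..
  have z: "{j\<in>J. P j (z \<sigma>) < 0} = \<sigma>" "i \<notin> I \<Longrightarrow> z \<sigma> i = 0"
    "i \<in> I \<Longrightarrow> z \<sigma> i ^ (2 * D + 1) = h i (z \<sigma>)" if "\<sigma> \<in> S" for \<sigma> i
    using bspec[OF zS that] by simp_all
  \<comment> \<open>The pattern \<open>\<sigma>\<close> can be read off from the signs at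
    \<open>z \<sigma>\<close>.\<close>
  have "inj_on z S" by (rule inj_onI) (metis z(1))
  then have "card S = card (z ` S)" by (simp add: card_image)
  also have "\<dots> \<le> (2 * D + 1) ^ card I"
  \<comment> \<open>Here \<open>m = 2 * D + 1\<close> is just above the degree bound
    \<open>D + D\<close> of the \<open>h i\<close>.\<close>
  proof (rule card_common_zeros_le[OF I, of "D + D" _ h])
    show "poly_fn I (D + D) (h i)" if "i \<in> I" for i
      unfolding h_def by (intro poly_fn_cmult poly_fn_mult F F'(1) that)
  qed (use z finS in auto)
  finally show ?thesis by (simp add: S_def D_def)
qed

section \<open>P-matrix orientations as sign patterns\<close>

text \<open>Cramer's rule gives the entry as a quotient with denominator \<open>det A\<close>;
  multiplying by the positive square of \<open>det A\<close> turns it into a polynomial without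
  changing the sign.\<close>

lemma sgn_inv_apply:
  assumes A: "A \<in> carrier_mat n n" and q: "q \<in> carrier_vec n" and i: "i < n"
    and nz: "inv_apply n A q $ i \<noteq> 0"
  shows "sgn (inv_apply n A q $ i) = sgn (det A * det (replace_col A q i))"
proof (cases "mat_inverse A")
  \<comment> \<open>The default zero vector contradicts \<open>nz\<close>, so a singular
    \<open>A\<close> cannot occur.\<close>
  case None
  then show ?thesis using nz i by (simp add: inv_apply_def)
next
  case (Some B)
  from mat_inverse(2)[OF A Some]
  have B: "A * B = 1\<^sub>m n" "B \<in> carrier_mat n n" by auto
  have "det A * det B = 1" using det_mult[OF A B(2)] B(1) by simp
  then have "det A \<noteq> 0" by auto
  have x: "inv_apply n A q = B *\<^sub>v q" using Some by (simp add: inv_apply_def)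
  have Bq: "B *\<^sub>v q \<in> carrier_vec n" using B q by simp
  have "A *\<^sub>v (B *\<^sub>v q) = q"
    using assoc_mult_mat_vec[OF A B(2) q] B(1) q by simp
  then have "det (replace_col A q i) = (B *\<^sub>v q) $ i * det A"
    using cramer_lemma_mat[OF A Bq i] by simp
  then have "det A * det (replace_col A q i) = (B *\<^sub>v q) $ i * (det A)\<^sup>2"
    by (simp add: power2_eq_square)
  moreover have "sgn ((det A)\<^sup>2) = 1" using \<open>det A \<noteq> 0\<close> by (intro sgn_pos) simp
  ultimately show ?thesis by (simp add: x sgn_mult)
qed

lemma A_mat_carrier: "A_mat n M B \<in> carrier_mat n n"
  by (simp add: A_mat_def)

text \<open>The pair \<open>(M, q)\<close> is encoded as a single point: column \<open>n\<close> holds \<open>q\<close>.\<close>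

definition LCP_mat :: "nat \<Rightarrow> (nat \<times> nat \<Rightarrow> real) \<Rightarrow> real mat" where
  "LCP_mat n x = mat n n x"

definition LCP_vec :: "nat \<Rightarrow> (nat \<times> nat \<Rightarrow> real) \<Rightarrow> real vec" where
  "LCP_vec n x = vec n (\<lambda>i. x (i, n))"

definition LCP_poly :: "nat \<Rightarrow> nat set \<times> nat \<Rightarrow> (nat \<times> nat \<Rightarrow> real) \<Rightarrow> real" where
  "LCP_poly n = (\<lambda>(B, i) x. det (A_mat n (LCP_mat n x) B) *
     det (replace_col (A_mat n (LCP_mat n x) B) (LCP_vec n x) i))"

text \<open>Every entry of the two matrices is a constant or, up to sign, a coordinate, so each
  \<open>n\<close> by \<open>n\<close> determinant has degree at most \<open>n\<close>.\<close>

lemma poly_fn_LCP_poly: "poly_fn ({..<n} \<times> {..n}) (2 * n) (LCP_poly n j)"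
proof -
  let ?I = "{..<n} \<times> {..n}"
  obtain B i where j: "j = (B, i)" by fastforce
  have A: "poly_fn ?I 1 (\<lambda>x. A_mat n (LCP_mat n x) B $$ (k, l))" if "k < n" "l < n" for k l
  proof (cases "l \<in> B")
    case True
    then show ?thesis
      using that by (auto simp: A_mat_def LCP_mat_def intro!: poly_fn_uminus poly_fn_coord)
  qed (use that in \<open>auto simp: A_mat_def intro: poly_fn_const\<close>)
  have "poly_fn ?I 1 (\<lambda>x. replace_col (A_mat n (LCP_mat n x) B) (LCP_vec n x) i $$ (k, l))"
    if "k < n" "l < n" for k l
  proof (cases "l = i")
    case True
    then show ?thesis
      using that by (auto simp: replace_col_def LCP_vec_def A_mat_def intro!: poly_fn_coord)
  next
    case False
    then have "replace_col (A_mat n M B) q i $$ (k, l) = A_mat n M B $$ (k, l)" for M q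
      using that by (simp add: replace_col_def A_mat_def)
    then show ?thesis using A[OF that] by simp
  qed
  then have "poly_fn ?I (n * 1 + n * 1) (LCP_poly n j)"
    unfolding j LCP_poly_def prod.case
    using A by (intro poly_fn_mult poly_fn_det) (auto simp: A_mat_def replace_col_def)
  then show ?thesis by (simp add: mult_2)
qed

text \<open>The negative \<open>LCP_poly\<close> values mark exactly the outgoing edges, so the
  pattern determines the orientation.\<close>

lemma P_USO_is_sign_pattern:
  assumes "P_USO n Or"
  defines "J \<equiv> Pow {0..<n} \<times> {..<n}"
  shows "\<exists>x. (\<forall>j\<in>J. LCP_poly n j x \<noteq> 0) \<and>
    Or = (\<lambda>(v, i). (v, flip v i)) ` {j\<in>J. LCP_poly n j x < 0}"
proof -
  obtain M q where Mq: "P_matrix n M" "q \<in> carrier_vec n" "nondegenerate n M q"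
    "Or = LCP_orientation n M q" using assms unfolding P_USO_def by blast
  have M: "M \<in> carrier_mat n n" using Mq(1) by (simp add: P_matrix_def)
  define x where "x = (\<lambda>(k, l). if l = n then q $ k else M $$ (k, l))"
  have xM: "LCP_mat n x = M" using M by (intro eq_matI) (auto simp: LCP_mat_def x_def)
  have xq: "LCP_vec n x = q" using Mq(2) by (intro eq_vecI) (auto simp: LCP_vec_def x_def)
  have nz: "inv_apply n (A_mat n M v) q $ i \<noteq> 0" if "v \<subseteq> {0..<n}" "i < n" for v i
    using Mq(3) that unfolding nondegenerate_def by blast
  have eq: "sgn (inv_apply n (A_mat n M v) q $ i) = sgn (LCP_poly n (v, i) x)"
    if "v \<subseteq> {0..<n}" "i < n" for v i
    using sgn_inv_apply[OF A_mat_carrier Mq(2) that(2) nz[OF that]]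
    by (simp add: LCP_poly_def xM xq)
  have sg: "LCP_poly n (v, i) x \<noteq> 0"
    "LCP_poly n (v, i) x < 0 \<longleftrightarrow> inv_apply n (A_mat n M v) q $ i < 0"
    if "v \<subseteq> {0..<n}" "i < n" for v i
    using nz[OF that] eq[OF that] by (metis sgn_0_0) (metis eq[OF that] sgn_less)
  have "\<forall>j\<in>J. LCP_poly n j x \<noteq> 0" using sg(1) by (auto simp: J_def)
  moreover have "Or = (\<lambda>(v, i). (v, flip v i)) ` {j\<in>J. LCP_poly n j x < 0}"
    unfolding Mq(4) LCP_orientation_def cube_vertices_def J_def
    using sg(2) by (auto simp: image_iff)
  ultimately show ?thesis by blast
qed

text \<open>The sign pattern bound is applied to \<open>2 ^ n * n\<close> polynomials of degree at
  most \<open>2 * n\<close> in \<open>n * (n + 1)\<close> variables.\<close>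

lemma card_P_USO_le:
  "card {Or. P_USO n Or} \<le> (2 * (2 ^ n * n * (2 * n)) + 1) ^ (n * (n + 1))"
proof -
  define J where "J = Pow {0..<n} \<times> {..<n}"
  let ?S = "{{j\<in>J. LCP_poly n j x < 0} | x. \<forall>j\<in>J. LCP_poly n j x \<noteq> 0}"
  have J: "finite J" "card J = 2 ^ n * n" by (simp_all add: J_def card_Pow)
  have "?S \<subseteq> Pow J" by auto
  then have fin: "finite ?S" using J(1) finite_subset by auto
  have "{Or. P_USO n Or} \<subseteq> (`) (\<lambda>(v, i). (v, flip v i)) ` ?S"
    using P_USO_is_sign_pattern[of n, folded J_def] by blast
  then have "card {Or. P_USO n Or} \<le> card ?S" by (rule surj_card_le[OF fin])
  also have "\<dots> \<le> (2 * (card J * (2 * n)) + 1) ^ card ({..<n} \<times> {..n})"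
    by (rule card_sign_patterns_le) (auto simp: J poly_fn_LCP_poly)
  finally show ?thesis by (simp add: J)
qed

theorem mainTheorem2:
  shows "\<exists>c::real. c > 0 \<and>
           (\<forall>n::nat. n \<ge> 1 \<longrightarrow> real (card {Or. P_USO n Or}) \<le> 2 powr (c * real n ^ 3))"
proof (intro exI conjI allI impI)
  fix n :: nat assume n: "n \<ge> 1"
  \<comment> \<open>With base at most \<open>2 ^ (6 * n)\<close> and
    \<open>n + 1 \<le> 2 * n\<close>, the total exponent is at most \<open>12 * n ^ 3\<close>; hence
    the witness \<open>c = 12\<close>.\<close>
  have "2 * (2 ^ n * n * (2 * n)) + 1 \<le> 2 ^ (6 * n)"
  proof -
    have le: "n \<le> 2 ^ n" using less_exp[of n] by simp
    have "1 \<le> (2::nat) ^ n * n * n" using n by simp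
    then have "2 * (2 ^ n * n * (2 * n)) + 1 \<le> 8 * (2 ^ n * n * n)" by simp
    also have "\<dots> \<le> 2 ^ (3 * n) * (2 ^ n * 2 ^ n * 2 ^ n)"
      using n le power_increasing[of 3 "3 * n" "2 :: nat"] by (intro mult_le_mono) auto
    also have "\<dots> = 2 ^ (6 * n)" by (simp flip: power_add)
    finally show ?thesis .
  qed
  then have "(2 * (2 ^ n * n * (2 * n)) + 1) ^ (n * (n + 1)) \<le> (2 ^ (6 * n)) ^ (n * (n + 1))"
    by (intro power_mono) auto
  also have "\<dots> = 2 ^ (6 * n * (n * (n + 1)))" by (simp only: power_mult)
  also have "\<dots> \<le> (2::nat) ^ (12 * n ^ 3)"
  proof (rule power_increasing)
    have "6 * n * (n * (n + 1)) \<le> 6 * n * (n * (n + n))"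
      using n by (intro mult_le_mono) auto
    also have "\<dots> = 12 * n ^ 3" by (simp add: power3_eq_cube)
    finally show "6 * n * (n * (n + 1)) \<le> 12 * n ^ 3" .
  qed simp
  finally have "card {Or. P_USO n Or} \<le> 2 ^ (12 * n ^ 3)"
    using card_P_USO_le[of n] by linarith
  then have "real (card {Or. P_USO n Or}) \<le> real (2 ^ (12 * n ^ 3))" by (rule of_nat_mono)
  also have "\<dots> = 2 powr real (12 * n ^ 3)" by (simp only: powr_realpow of_nat_power of_nat_numeral zero_less_numeral)
  also have "\<dots> = 2 powr (12 * real n ^ 3)" by simp
  finally show "real (card {Or. P_USO n Or}) \<le> 2 powr (12 * real n ^ 3)" .
qed simp

end
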